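(* There exists a bielliptic trapezoid of class $\tau$ for some $\tau>0$.
   Context: A trapezoid is a convex quadrilateral with at least one pair of parallel sides. Ellipses are nondegenerate and include circles. If an ellipse has semi-major axis length $a$ and semi-minor axis length $b$ ($a\ge b>0$), its eccentricity is $\sqrt{1-b^2/a^2}$. For a convex quadrilateral $R$ in the $xy$-plane, an ellipse is inscribed in $R$ if it lies in $R$ and is tangent to each of the four sides of $R$, and circumscribed about $R$ if it passes through the four vertices of $R$. Let $E_I$ denote the unique ellipse of minimal eccentricity among all ellipses inscribed in $R$, and let $E_O$ denote the unique ellipse of minimal eccentricity among all ellipses circumscribed about $R$. $R$ is called bielliptic if $E_I$ and $E_O$ have the same eccentricity; a bielliptic $R$ is said to be of class $\tau$, $0\le\tau<1$, if $E_I$ and $E_O$ each have eccentricity $\tau$. *)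

theory Defs
  imports "HOL-Analysis.Analysis"
begin

text \<open>A convex quadrilateral is the closed convex region, that is, a polytope in the plane with
  exactly four vertices (four extreme points force it to be two-dimensional and its vertices to be
  in strictly convex position).  Its sides are its one-dimensional faces, \<open>s edge_of R\<close>.\<close>

definition vertices :: "(real^2) set \<Rightarrow> (real^2) set" where
  "vertices R = {v. v extreme_point_of R}"

definition convex_quadrilateral :: "(real^2) set \<Rightarrow> bool" where
  "convex_quadrilateral R \<longleftrightarrow> polytope R \<and> card (vertices R) = 4"

definition trapezoid :: "(real^2) set \<Rightarrow> bool" where
  "trapezoid R \<longleftrightarrow> convex_quadrilateral R \<and>
     (\<exists>s t. s edge_of R \<and> t edge_of R \<and> s \<noteq> t \<and>
            affine_parallel (affine hull s) (affine hull t))"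

text \<open>An ellipse is the curve, not the enclosed region.  The vectors \<open>u\<close> and \<open>v\<close> are the unit
  directions of the major and minor axes.\<close>

definition ellipse_with_semiaxes :: "(real^2) set \<Rightarrow> real \<Rightarrow> real \<Rightarrow> bool" where
  "ellipse_with_semiaxes E a b \<longleftrightarrow> a \<ge> b \<and> b > 0 \<and>
     (\<exists>c u v. norm u = 1 \<and> norm v = 1 \<and> u \<bullet> v = 0 \<and>
        E = {c + x *\<^sub>R u + y *\<^sub>R v | x y. x\<^sup>2 / a\<^sup>2 + y\<^sup>2 / b\<^sup>2 = 1})"

definition ellipse :: "(real^2) set \<Rightarrow> bool" where
  "ellipse E \<longleftrightarrow> (\<exists>a b. ellipse_with_semiaxes E a b)"

definition eccentricity :: "(real^2) set \<Rightarrow> real" where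
  "eccentricity E = (THE e. \<exists>a b. ellipse_with_semiaxes E a b \<and> e = sqrt (1 - b\<^sup>2 / a\<^sup>2))"

text \<open>The semi-axes are determined by the point set, so the description above is proper.\<close>

lemma parallelogram_law:
  fixes x y :: "real^2"
  shows "(norm (x + y))\<^sup>2 + (norm (x - y))\<^sup>2 = 2 * (norm x)\<^sup>2 + 2 * (norm y)\<^sup>2"
  unfolding power2_norm_eq_inner
  by (simp add: inner_diff_left inner_diff_right inner_add_left inner_add_right)

lemma ellipse_dist_bounds:
  fixes u v :: "real^2"
  assumes "a \<ge> b" "b > 0" "norm u = 1" "norm v = 1" "u \<bullet> v = 0"
    and "x\<^sup>2 / a\<^sup>2 + y\<^sup>2 / b\<^sup>2 = 1"
  shows "b\<^sup>2 \<le> (norm (x *\<^sub>R u + y *\<^sub>R v))\<^sup>2" "(norm (x *\<^sub>R u + y *\<^sub>R v))\<^sup>2 \<le> a\<^sup>2"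
proof -
  have "u \<bullet> u = 1" "v \<bullet> v = 1"
    using assms(3,4) by (simp_all add: norm_eq_1)
  then have n: "(norm (x *\<^sub>R u + y *\<^sub>R v))\<^sup>2 = x\<^sup>2 + y\<^sup>2"
    using assms(5) unfolding power2_norm_eq_inner
    by (simp add: inner_add_left inner_add_right inner_commute[of v u] power2_eq_square)
  have ab: "b\<^sup>2 \<le> a\<^sup>2" "0 < b\<^sup>2"
    using assms(1,2) by (auto intro: power_mono)
  then have a2: "0 < a\<^sup>2" by linarith
  have x: "x\<^sup>2 / a\<^sup>2 \<le> x\<^sup>2 / b\<^sup>2" and y: "y\<^sup>2 / a\<^sup>2 \<le> y\<^sup>2 / b\<^sup>2"
    using ab a2 by (auto intro!: divide_left_mono)
  have "1 \<le> (x\<^sup>2 + y\<^sup>2) / b\<^sup>2"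
    using x assms(6) by (simp add: add_divide_distrib)
  moreover have "(x\<^sup>2 + y\<^sup>2) / a\<^sup>2 \<le> 1"
    using y assms(6) by (simp add: add_divide_distrib)
  ultimately show "b\<^sup>2 \<le> (norm (x *\<^sub>R u + y *\<^sub>R v))\<^sup>2" "(norm (x *\<^sub>R u + y *\<^sub>R v))\<^sup>2 \<le> a\<^sup>2"
    using ab a2 n by (simp_all add: divide_simps)
qed

lemma ellipse_with_semiaxes_bounds:
  assumes "ellipse_with_semiaxes E a b"
  shows "\<exists>c u v. norm u = 1 \<and> norm v = 1 \<and>
    c + a *\<^sub>R u \<in> E \<and> c - a *\<^sub>R u \<in> E \<and> c + b *\<^sub>R v \<in> E \<and>
    (\<forall>p\<in>E. b \<le> dist p c \<and> dist p c \<le> a) \<and> 0 < b \<and> b \<le> a"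
proof -
  from assms obtain c u v where *: "a \<ge> b" "b > 0" "norm u = 1" "norm v = 1" "u \<bullet> v = 0"
    and E: "E = {c + x *\<^sub>R u + y *\<^sub>R v | x y. x\<^sup>2 / a\<^sup>2 + y\<^sup>2 / b\<^sup>2 = 1}"
    unfolding ellipse_with_semiaxes_def by blast
  have mem: "c + x *\<^sub>R u + y *\<^sub>R v \<in> E" if "x\<^sup>2 / a\<^sup>2 + y\<^sup>2 / b\<^sup>2 = 1" for x y
    using that unfolding E by blast
  show ?thesis
  proof (rule exI[of _ c], rule exI[of _ u], rule exI[of _ v], intro conjI ballI)
    show "c + a *\<^sub>R u \<in> E"
      using mem[of a 0] * by simp
    show "c - a *\<^sub>R u \<in> E"
      using mem[of "-a" 0] * by simp
    show "c + b *\<^sub>R v \<in> E"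
      using mem[of 0 b] * by simp
    fix p
    assume "p \<in> E"
    then obtain x y where p: "p = c + x *\<^sub>R u + y *\<^sub>R v" "x\<^sup>2 / a\<^sup>2 + y\<^sup>2 / b\<^sup>2 = 1"
      unfolding E by blast
    then have d: "dist p c = norm (x *\<^sub>R u + y *\<^sub>R v)"
      by (simp add: dist_norm algebra_simps)
    show "b \<le> dist p c"
      unfolding d using ellipse_dist_bounds(1)[OF * p(2)] power2_le_imp_le norm_ge_zero by blast
    show "dist p c \<le> a"
      unfolding d by (rule power2_le_imp_le[OF ellipse_dist_bounds(2)[OF * p(2)]])
        (use *(1,2) in linarith)
  qed (use * in simp_all)
qed

lemma ellipse_semiaxes_unique:
  assumes "ellipse_with_semiaxes E a b" "ellipse_with_semiaxes E a' b'"
  shows "a = a'" "b = b'"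
proof -
  have key: "A' = A \<and> C' = C"
    if n: "norm U = 1" and mem: "C + A *\<^sub>R U \<in> E" "C - A *\<^sub>R U \<in> E"
      and le: "\<And>p. p \<in> E \<Longrightarrow> dist p C' \<le> A'" and A: "A' \<le> A" "0 \<le> A'"
    for A A' :: real and U C C' :: "real^2"
  proof -
    have "(norm (C + A *\<^sub>R U - C'))\<^sup>2 \<le> A'\<^sup>2" "(norm (C - A *\<^sub>R U - C'))\<^sup>2 \<le> A'\<^sup>2"
      using le[OF mem(1)] le[OF mem(2)] by (auto simp: dist_norm intro!: power_mono)
    moreover have "(norm (C + A *\<^sub>R U - C'))\<^sup>2 + (norm (C - A *\<^sub>R U - C'))\<^sup>2
        = 2 * (norm (C - C'))\<^sup>2 + 2 * A\<^sup>2"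
    proof -
      have *: "C + A *\<^sub>R U - C' = (C - C') + A *\<^sub>R U" "C - A *\<^sub>R U - C' = (C - C') - A *\<^sub>R U"
        by simp_all
      show ?thesis
        unfolding *
        using parallelogram_law[of "C - C'" "A *\<^sub>R U"] n by (simp add: power_mult_distrib)
    qed
    moreover have "A'\<^sup>2 \<le> A\<^sup>2" using A by (rule power_mono)
    moreover have "0 \<le> (norm (C - C'))\<^sup>2" by simp
    ultimately have "(norm (C - C'))\<^sup>2 = 0" "A'\<^sup>2 = A\<^sup>2" by linarith+
    then show ?thesis using A by (auto simp: power2_eq_iff)
  qed
  obtain c u v where 1: "norm u = 1" "norm v = 1"
    "c + a *\<^sub>R u \<in> E" "c - a *\<^sub>R u \<in> E" "c + b *\<^sub>R v \<in> E"
    "\<forall>p\<in>E. b \<le> dist p c \<and> dist p c \<le> a" "0 < b" "b \<le> a"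
    using ellipse_with_semiaxes_bounds[OF assms(1)] by blast
  obtain c' u' v' where 2: "norm u' = 1" "norm v' = 1"
    "c' + a' *\<^sub>R u' \<in> E" "c' - a' *\<^sub>R u' \<in> E" "c' + b' *\<^sub>R v' \<in> E"
    "\<forall>p\<in>E. b' \<le> dist p c' \<and> dist p c' \<le> a'" "0 < b'" "b' \<le> a'"
    using ellipse_with_semiaxes_bounds[OF assms(2)] by blast
  have eq: "a = a' \<and> c = c'"
  proof (cases "a' \<le> a")
    case True
    then have "a' = a \<and> c' = c"
      by (intro key[OF 1(1,3,4)]) (use 2(6-8) in auto)
    then show ?thesis by simp
  next
    case False
    then show ?thesis
      by (intro key[OF 2(1,3,4)]) (use 1(6-8) in auto)
  qed
  then show "a = a'" by simp
  have "b' \<le> dist (c + b *\<^sub>R v) c'" "b \<le> dist (c' + b' *\<^sub>R v') c"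
    using 2(6) 1(5) 1(6) 2(5) by blast+
  then have "b' \<le> b" "b \<le> b'"
    using eq 1(2,7) 2(2,7) by (simp_all add: dist_norm)
  then show "b = b'" by simp
qed

lemma eccentricity_eq:
  assumes "ellipse_with_semiaxes E a b"
  shows "eccentricity E = sqrt (1 - b\<^sup>2 / a\<^sup>2)"
  unfolding eccentricity_def
  using assms ellipse_semiaxes_unique[OF assms] by (intro the_equality) blast+

text \<open>\<open>L\<close> is tangent to \<open>E\<close> at \<open>p\<close>: it is the line through \<open>p\<close> in the direction of a nonzero velocity
  vector at \<open>p\<close> of a curve running inside \<open>E\<close>.\<close>

definition tangent_line_at :: "(real^2) set \<Rightarrow> real^2 \<Rightarrow> (real^2) set \<Rightarrow> bool" where
  "tangent_line_at E p L \<longleftrightarrow>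
     (\<exists>\<gamma> t d. range \<gamma> \<subseteq> E \<and> \<gamma> t = p \<and> (\<gamma> has_vector_derivative d) (at (t::real)) \<and>
        d \<noteq> 0 \<and> L = {p + k *\<^sub>R d | k. True})"

text \<open>Tangency to a side means that the point of contact lies on the side itself, not merely on
  the line extending it.\<close>

definition inscribed :: "(real^2) set \<Rightarrow> (real^2) set \<Rightarrow> bool" where
  "inscribed E R \<longleftrightarrow> ellipse E \<and> E \<subseteq> R \<and>
     (\<forall>s. s edge_of R \<longrightarrow> (\<exists>p\<in>s. tangent_line_at E p (affine hull s)))"

definition circumscribed :: "(real^2) set \<Rightarrow> (real^2) set \<Rightarrow> bool" where
  "circumscribed E R \<longleftrightarrow> ellipse E \<and> vertices R \<subseteq> E"

definition unique_min_eccentricity :: "((real^2) set \<Rightarrow> bool) \<Rightarrow> (real^2) set \<Rightarrow> bool" where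
  "unique_min_eccentricity P E \<longleftrightarrow>
     P E \<and> (\<forall>E'. P E' \<and> E' \<noteq> E \<longrightarrow> eccentricity E < eccentricity E')"

definition bielliptic :: "(real^2) set \<Rightarrow> bool" where
  "bielliptic R \<longleftrightarrow> convex_quadrilateral R \<and>
     (\<exists>E\<^sub>I E\<^sub>O. unique_min_eccentricity (\<lambda>E. inscribed E R) E\<^sub>I \<and>
        unique_min_eccentricity (\<lambda>E. circumscribed E R) E\<^sub>O \<and>
        eccentricity E\<^sub>I = eccentricity E\<^sub>O)"

definition bielliptic_of_class :: "(real^2) set \<Rightarrow> real \<Rightarrow> bool" where
  "bielliptic_of_class R \<tau> \<longleftrightarrow> bielliptic R \<and> 0 \<le> \<tau> \<and> \<tau> < 1 \<and>
     (\<exists>E\<^sub>I E\<^sub>O. unique_min_eccentricity (\<lambda>E. inscribed E R) E\<^sub>I \<and>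
        unique_min_eccentricity (\<lambda>E. circumscribed E R) E\<^sub>O \<and>
        eccentricity E\<^sub>I = \<tau> \<and> eccentricity E\<^sub>O = \<tau>)"

end

theory Submission
  imports Defs
begin

text \<open>The witness is a parallelogram, which is a trapezoid with two pairs of parallel sides.

  An ellipse is a conic \<open>q (p - c) = 1\<close> with \<open>q\<close> a positive definite quadratic form of trace \<open>T\<close> and
  determinant \<open>D\<close>.  The eigenvalues of \<open>q\<close> are the inverse squares of the semi-axes, so the
  quantity \<open>T\<^sup>2 / D\<close> equals \<open>4 + \<epsilon>\<^sup>4 / (1 - \<epsilon>\<^sup>2)\<close>, an increasing function of the eccentricity \<open>\<epsilon>\<close>
  (\<open>eccentricity_less_conic_iff\<close>).  Minimizing the eccentricity thus amounts to minimizing a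
  rational function of the coefficients.

  Let the parallelogram have vertices \<open>\<plusminus> e \<plusminus> f\<close>.  Central symmetry forces every inscribed and
  every circumscribed ellipse to have its centre at \<open>0\<close>, and it leaves two linear conditions on the
  form of a circumscribed ellipse (\<open>circumscribed_parallelogram_iff\<close>) or on the inverse of
  the form of an inscribed one (\<open>inscribed_parallelogram_iff\<close>).  Both families therefore have one
  parameter.  The minimum of \<open>T\<^sup>2 / D\<close> is
  \<open>4 |e|\<^sup>2 |f|\<^sup>2 / G\<close> on the circumscribed family and \<open>((|e|\<^sup>2 + |f|\<^sup>2)\<^sup>2 - 4 (e \<bullet> f)\<^sup>2) / G\<close> on the
  inscribed one, where \<open>G = |e|\<^sup>2 |f|\<^sup>2 - (e \<bullet> f)\<^sup>2\<close>.  They agree exactly when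
  \<open>||e|\<^sup>2 - |f|\<^sup>2| = 2 |e \<bullet> f|\<close>.  A solution with orthogonal \<open>e\<close> and \<open>f\<close> is a square, of
  class \<open>0\<close>; the vectors \<open>e = (2, 1)\<close> and \<open>f = (1, 0)\<close> are a solution with \<open>e \<bullet> f \<noteq> 0\<close>, for which
  both minima are \<open>20\<close>.  Since \<open>20 > 4\<close>, the common eccentricity is positive.\<close>

section \<open>Ellipses as conics\<close>

definition qform :: "real \<Rightarrow> real \<Rightarrow> real \<Rightarrow> real^2 \<Rightarrow> real" where
  "qform \<alpha> \<beta> \<gamma> p = \<alpha> * (p$1)\<^sup>2 + 2 * \<beta> * p$1 * p$2 + \<gamma> * (p$2)\<^sup>2"

definition conic_ellipse :: "(real^2) set \<Rightarrow> real^2 \<Rightarrow> real \<Rightarrow> real \<Rightarrow> real \<Rightarrow> bool" where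
  "conic_ellipse E c \<alpha> \<beta> \<gamma> \<longleftrightarrow>
     0 < \<alpha> \<and> 0 < \<alpha> * \<gamma> - \<beta>\<^sup>2 \<and> E = {p. qform \<alpha> \<beta> \<gamma> (p - c) = 1}"

lemma inner_real2: "(x :: real^2) \<bullet> y = x$1 * y$1 + x$2 * y$2"
  by (simp add: inner_vec_def sum_2)

lemma eq_real2_iff: "(x :: real^2) = y \<longleftrightarrow> x$1 = y$1 \<and> x$2 = y$2"
  by (simp add: vec_eq_iff forall_2)

text \<open>In the plane \<open>v\<close> can only be \<open>u\<close> turned by a right angle, to one side or the other; the sign
  \<open>s\<close> records which.\<close>

lemma orthonormal_real2:
  fixes u v :: "real^2"
  assumes "norm u = 1" "norm v = 1" "u \<bullet> v = 0"
  obtains s where "s\<^sup>2 = 1" "v$1 = - s * u$2" "v$2 = s * u$1" "(u$1)\<^sup>2 + (u$2)\<^sup>2 = 1"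
proof -
  have u: "u$1 * u$1 + u$2 * u$2 = 1" and v: "v$1 * v$1 + v$2 * v$2 = 1"
    and uv: "u$1 * v$1 + u$2 * v$2 = 0"
    using assms by (simp_all add: norm_eq_1 inner_real2)
  define s where "s = u$1 * v$2 - u$2 * v$1"
  have "s\<^sup>2 = 1" "v$1 = - s * u$2" "v$2 = s * u$1"
    using u v uv unfolding s_def power2_eq_square by algebra+
  with u show thesis by (intro that) (auto simp: power2_eq_square)
qed

text \<open>The form on the right is \<open>A (w \<bullet> u)\<^sup>2 + B (w \<bullet> v)\<^sup>2\<close> written out in coordinates, and \<open>w \<bullet> u\<close>,
  \<open>w \<bullet> v\<close> are the coordinates of \<open>w\<close> in the orthonormal basis.\<close>

lemma axes_parametrization_eq_conic:
  fixes u v c :: "real^2"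
  assumes "norm u = 1" "norm v = 1" "u \<bullet> v = 0"
  shows "{c + x *\<^sub>R u + y *\<^sub>R v | x y. A * x\<^sup>2 + B * y\<^sup>2 = 1} =
    {p. qform (A * (u$1)\<^sup>2 + B * (v$1)\<^sup>2) (A * u$1 * u$2 + B * v$1 * v$2)
              (A * (u$2)\<^sup>2 + B * (v$2)\<^sup>2) (p - c) = 1}" (is "?L = {p. ?q (p - c) = 1}")
proof -
  obtain s where s: "s\<^sup>2 = 1" "v$1 = - s * u$2" "v$2 = s * u$1" "(u$1)\<^sup>2 + (u$2)\<^sup>2 = 1"
    using orthonormal_real2[OF assms] .
  have q: "?q w = A * (w \<bullet> u)\<^sup>2 + B * (w \<bullet> v)\<^sup>2" for w
    by (simp add: qform_def inner_real2 power2_eq_square algebra_simps)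
  have expand: "w = (w \<bullet> u) *\<^sub>R u + (w \<bullet> v) *\<^sub>R v" for w
    using s unfolding eq_real2_iff inner_real2 by simp algebra
  have uu: "u \<bullet> u = 1" "v \<bullet> v = 1" "v \<bullet> u = 0"
    using assms by (simp_all add: norm_eq_1 inner_commute)
  show ?thesis
  proof (intro subset_antisym subsetI)
    fix p assume "p \<in> ?L"
    then show "p \<in> {p. ?q (p - c) = 1}"
      by (auto simp: q inner_add_left uu assms(3))
  next
    fix p assume "p \<in> {p. ?q (p - c) = 1}"
    moreover have "p = c + ((p - c) \<bullet> u) *\<^sub>R u + ((p - c) \<bullet> v) *\<^sub>R v"
      using expand[of "p - c"] by (simp add: algebra_simps)
    ultimately show "p \<in> ?L"
      unfolding q by blast
  qed
qed

lemma ellipse_imp_conic: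
  assumes "ellipse E"
  obtains c \<alpha> \<beta> \<gamma> where "conic_ellipse E c \<alpha> \<beta> \<gamma>"
proof -
  obtain a b c u v where *: "a \<ge> b" "b > 0" "norm u = 1" "norm v = 1" "u \<bullet> v = 0"
    and E: "E = {c + x *\<^sub>R u + y *\<^sub>R v | x y. x\<^sup>2 / a\<^sup>2 + y\<^sup>2 / b\<^sup>2 = 1}"
    using assms unfolding ellipse_def ellipse_with_semiaxes_def by blast
  obtain s where s: "s\<^sup>2 = 1" "v$1 = - s * u$2" "v$2 = s * u$1" "(u$1)\<^sup>2 + (u$2)\<^sup>2 = 1"
    using orthonormal_real2[OF *(3-5)] .
  define A B where "A = 1 / a\<^sup>2" and "B = 1 / b\<^sup>2"
  have pos: "A > 0" "B > 0"
    using * by (simp_all add: A_def B_def)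
  let ?\<alpha> = "A * (u$1)\<^sup>2 + B * (v$1)\<^sup>2" and ?\<beta> = "A * u$1 * u$2 + B * v$1 * v$2"
    and ?\<gamma> = "A * (u$2)\<^sup>2 + B * (v$2)\<^sup>2"
  have "E = {p. qform ?\<alpha> ?\<beta> ?\<gamma> (p - c) = 1}"
    using axes_parametrization_eq_conic[OF *(3-5), of c A B] unfolding E A_def B_def by simp
  moreover have "?\<alpha> * ?\<gamma> - ?\<beta>\<^sup>2 = A * B"
    using s by algebra
  moreover have "?\<alpha> > 0"
  proof (cases "u$1 = 0")
    case True
    then have "(v$1)\<^sup>2 = 1" using s by (simp add: power_mult_distrib)
    then show ?thesis using pos True by simp
  next
    case False
    then show ?thesis using pos by (intro add_pos_nonneg) auto
  qed
  ultimately show thesis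
    using pos by (intro that[of c ?\<alpha> ?\<beta> ?\<gamma>]) (simp add: conic_ellipse_def)
qed

text \<open>This is the principal axis theorem in the plane.  In the orthonormal basis turned by \<open>\<theta>\<close> the
  off-diagonal coefficient of the form vanishes when \<open>(\<gamma> - \<alpha>, - 2 \<beta>)\<close> is a nonnegative multiple of
  \<open>(cos (2 \<theta>), sin (2 \<theta>))\<close>.  The diagonal is then \<open>(T - D) / 2\<close>, \<open>(T + D) / 2\<close>, where \<open>T\<close> is the
  trace and \<open>D\<close> the length of that vector; these are positive because \<open>T\<^sup>2 - D\<^sup>2\<close> is four times
  the determinant.  The two equations are the invariance of trace and determinant.\<close>

lemma conic_imp_semiaxes:
  assumes "conic_ellipse E c \<alpha> \<beta> \<gamma>"
  obtains a b where "ellipse_with_semiaxes E a b"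
    "1 / a\<^sup>2 + 1 / b\<^sup>2 = \<alpha> + \<gamma>" "1 / a\<^sup>2 * (1 / b\<^sup>2) = \<alpha> * \<gamma> - \<beta>\<^sup>2"
proof -
  have \<alpha>: "\<alpha> > 0" and det: "0 < \<alpha> * \<gamma> - \<beta>\<^sup>2" and E: "E = {p. qform \<alpha> \<beta> \<gamma> (p - c) = 1}"
    using assms by (auto simp: conic_ellipse_def)
  have "\<alpha> * \<gamma> > 0"
    using det zero_le_power2[of \<beta>] by linarith
  then have \<gamma>: "\<gamma> > 0"
    using \<alpha> by (simp add: zero_less_mult_iff)
  define D where "D = sqrt ((\<alpha> - \<gamma>)\<^sup>2 + (2 * \<beta>)\<^sup>2)"
  have D2: "D\<^sup>2 = (\<alpha> - \<gamma>)\<^sup>2 + (2 * \<beta>)\<^sup>2" and D0: "D \<ge> 0"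
    by (simp_all add: D_def)
  have "D\<^sup>2 < (\<alpha> + \<gamma>)\<^sup>2"
    using det unfolding D2 by (simp add: power2_eq_square algebra_simps)
  then have DT: "D < \<alpha> + \<gamma>"
    using \<alpha> \<gamma> power2_less_imp_less by fastforce
  obtain \<theta> where \<theta>: "\<alpha> - \<gamma> = - D * cos (2 * \<theta>)" "2 * \<beta> = - D * sin (2 * \<theta>)"
  proof (cases "D = 0")
    case True
    then have "(\<alpha> - \<gamma>)\<^sup>2 + (2 * \<beta>)\<^sup>2 = 0"
      unfolding D2[symmetric] by simp
    then have "\<alpha> - \<gamma> = 0 \<and> 2 * \<beta> = 0"
      by (simp only: sum_power2_eq_zero_iff)
    with True show thesis using that[of 0] by simp
  next
    case False
    have "((\<gamma> - \<alpha>) / D)\<^sup>2 + (- 2 * \<beta> / D)\<^sup>2 = ((\<alpha> - \<gamma>)\<^sup>2 + (2 * \<beta>)\<^sup>2) / D\<^sup>2"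
      by (simp add: power_divide add_divide_distrib power2_commute)
    also have "\<dots> = 1"
      using False unfolding D2[symmetric] by simp
    finally obtain t where "(\<gamma> - \<alpha>) / D = cos t" "- 2 * \<beta> / D = sin t"
      using sincos_total_2pi by metis
    then show thesis
      using False that[of "t / 2"] by (simp add: field_simps)
  qed
  have axes_formula:
    "(\<alpha> + \<gamma> - D) / 2 * (x * x) + (\<alpha> + \<gamma> + D) / 2 * (y * y) = \<alpha>"
    "(\<alpha> + \<gamma> - D) / 2 * (x * y) - (\<alpha> + \<gamma> + D) / 2 * (y * x) = \<beta>"
    "(\<alpha> + \<gamma> - D) / 2 * (y * y) + (\<alpha> + \<gamma> + D) / 2 * (x * x) = \<gamma>"
    if "\<alpha> - \<gamma> = - D * (x * x - y * y)" "2 * \<beta> = - D * (2 * y * x)" "x * x + y * y = 1" for x y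
  proof -
    have "(\<alpha> + \<gamma> - D) * (x * x) + (\<alpha> + \<gamma> + D) * (y * y) = 2 * \<alpha>"
      "(\<alpha> + \<gamma> - D) * (x * y) - (\<alpha> + \<gamma> + D) * (y * x) = 2 * \<beta>"
      "(\<alpha> + \<gamma> - D) * (y * y) + (\<alpha> + \<gamma> + D) * (x * x) = 2 * \<gamma>"
      using that by algebra+
    then show "(\<alpha> + \<gamma> - D) / 2 * (x * x) + (\<alpha> + \<gamma> + D) / 2 * (y * y) = \<alpha>"
      "(\<alpha> + \<gamma> - D) / 2 * (x * y) - (\<alpha> + \<gamma> + D) / 2 * (y * x) = \<beta>"
      "(\<alpha> + \<gamma> - D) / 2 * (y * y) + (\<alpha> + \<gamma> + D) / 2 * (x * x) = \<gamma>"
      by simp_all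
  qed
  define A B where "A = (\<alpha> + \<gamma> - D) / 2" and "B = (\<alpha> + \<gamma> + D) / 2"
  have AB: "0 < A" "A \<le> B"
    using DT D0 by (simp_all add: A_def B_def)
  define u v :: "real^2" where "u = vector [cos \<theta>, sin \<theta>]" and "v = vector [- sin \<theta>, cos \<theta>]"
  have uv: "norm u = 1" "norm v = 1" "u \<bullet> v = 0"
    by (simp_all add: norm_eq_1 inner_real2 u_def v_def flip: power2_eq_square)
  have cs: "cos \<theta> * cos \<theta> + sin \<theta> * sin \<theta> = 1"
    by (simp flip: power2_eq_square)
  have "A * (u$1)\<^sup>2 + B * (v$1)\<^sup>2 = \<alpha>" "A * u$1 * u$2 + B * v$1 * v$2 = \<beta>"
    "A * (u$2)\<^sup>2 + B * (v$2)\<^sup>2 = \<gamma>"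
    using axes_formula[OF \<theta>[unfolded cos_double sin_double power2_eq_square] cs]
    by (simp_all add: A_def B_def u_def v_def power2_eq_square mult.assoc)
  then have E': "E = {c + x *\<^sub>R u + y *\<^sub>R v | x y. A * x\<^sup>2 + B * y\<^sup>2 = 1}"
    using axes_parametrization_eq_conic[OF uv, of c A B] unfolding E by simp
  define a b where "a = 1 / sqrt A" and "b = 1 / sqrt B"
  have ab: "1 / a\<^sup>2 = A" "1 / b\<^sup>2 = B" "b > 0" "a \<ge> b"
    using AB by (auto simp: a_def b_def power_divide intro!: divide_left_mono)
  have "x\<^sup>2 / a\<^sup>2 = A * x\<^sup>2" "x\<^sup>2 / b\<^sup>2 = B * x\<^sup>2" for x
    using ab(1,2) by (metis mult.commute mult_1 times_divide_eq_left)+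
  then have "ellipse_with_semiaxes E a b"
    unfolding ellipse_with_semiaxes_def E' using ab uv by auto
  moreover have "A + B = \<alpha> + \<gamma>"
    by (simp add: A_def B_def field_simps)
  moreover have "A * B = \<alpha> * \<gamma> - \<beta>\<^sup>2"
  proof -
    have "4 * (A * B) = (\<alpha> + \<gamma>)\<^sup>2 - D\<^sup>2"
      by (simp add: A_def B_def power2_eq_square field_simps)
    then show ?thesis unfolding D2 by (simp add: power2_eq_square algebra_simps)
  qed
  ultimately show thesis
    by (intro that[of a b]) (simp_all only: ab(1,2))
qed

lemma conic_imp_ellipse: "conic_ellipse E c \<alpha> \<beta> \<gamma> \<Longrightarrow> ellipse E"
  by (metis conic_imp_semiaxes ellipse_def)

text \<open>With \<open>r = b\<^sup>2 / a\<^sup>2 = 1 - \<epsilon>\<^sup>2\<close> the quotient of squared trace and determinant is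
  \<open>(1 + r)\<^sup>2 / r = 4 + (1 - r)\<^sup>2 / r\<close>.  It is free of scale, as the eccentricity is.\<close>

lemma eccentricity_conic:
  assumes "conic_ellipse E c \<alpha> \<beta> \<gamma>"
  shows "0 \<le> eccentricity E" "eccentricity E < 1"
    "(\<alpha> + \<gamma>)\<^sup>2 / (\<alpha> * \<gamma> - \<beta>\<^sup>2) = 4 + (eccentricity E)^4 / (1 - (eccentricity E)\<^sup>2)"
proof -
  obtain a b where ab: "ellipse_with_semiaxes E a b" and
    eqs: "1 / a\<^sup>2 + 1 / b\<^sup>2 = \<alpha> + \<gamma>" "1 / a\<^sup>2 * (1 / b\<^sup>2) = \<alpha> * \<gamma> - \<beta>\<^sup>2"
    using conic_imp_semiaxes[OF assms] .
  have pos: "0 < b" "b \<le> a"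
    using ab by (auto simp: ellipse_with_semiaxes_def)
  define r where "r = b\<^sup>2 / a\<^sup>2"
  have r: "0 < r" "r \<le> 1"
    using pos by (simp_all add: r_def power_mono)
  have e: "eccentricity E = sqrt (1 - r)"
    using eccentricity_eq[OF ab] by (simp add: r_def)
  then show "0 \<le> eccentricity E" "eccentricity E < 1"
    using r by simp_all
  have e2: "(eccentricity E)\<^sup>2 = 1 - r"
    using r by (simp add: e)
  have "(\<alpha> + \<gamma>)\<^sup>2 / (\<alpha> * \<gamma> - \<beta>\<^sup>2) = (1 + r)\<^sup>2 / r"
    using pos unfolding eqs[symmetric] r_def by (simp add: field_simps power2_eq_square)
  also have "\<dots> = 4 + (1 - r)\<^sup>2 / r"
    using r by (simp add: field_simps power2_eq_square)
  also have "(1 - r)\<^sup>2 = (eccentricity E)^4"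
    unfolding e2[symmetric] by simp
  finally show "(\<alpha> + \<gamma>)\<^sup>2 / (\<alpha> * \<gamma> - \<beta>\<^sup>2) = 4 + (eccentricity E)^4 / (1 - (eccentricity E)\<^sup>2)"
    by (simp add: e2)
qed

lemma eccentricity_less_conic_iff:
  assumes E: "conic_ellipse E c \<alpha> \<beta> \<gamma>" and E': "conic_ellipse E' c' \<alpha>' \<beta>' \<gamma>'"
  shows "eccentricity E < eccentricity E' \<longleftrightarrow>
    (\<alpha> + \<gamma>)\<^sup>2 / (\<alpha> * \<gamma> - \<beta>\<^sup>2) < (\<alpha>' + \<gamma>')\<^sup>2 / (\<alpha>' * \<gamma>' - \<beta>'\<^sup>2)"
proof -
  have mono: "x^4 / (1 - x\<^sup>2) < y^4 / (1 - y\<^sup>2)" if "0 \<le> x" "x < y" "y < 1" for x y :: real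
    using that
    by (intro frac_less power_strict_mono diff_left_mono power_mono)
       (auto simp: power_less_one_iff abs_square_less_1)
  show ?thesis
    using mono[of "eccentricity E" "eccentricity E'"] mono[of "eccentricity E'" "eccentricity E"]
      eccentricity_conic[OF E] eccentricity_conic[OF E']
    by (cases "eccentricity E" "eccentricity E'" rule: linorder_cases) auto
qed

section \<open>Supporting lines and tangents of a conic\<close>

lemma conic_symmetric:
  assumes "conic_ellipse E c \<alpha> \<beta> \<gamma>" "p \<in> E"
  shows "2 *\<^sub>R c - p \<in> E"
  using assms by (simp add: conic_ellipse_def qform_def power2_eq_square algebra_simps)

text \<open>The quadratic form of the inverse matrix: its square root is the support function of the conic,
  so that the line \<open>k \<bullet> p = 1\<close> is tangent to \<open>qform \<alpha> \<beta> \<gamma> p = 1\<close> exactly when the value at \<open>k\<close> is \<open>1\<close>.\<close>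

definition dual_form :: "real \<Rightarrow> real \<Rightarrow> real \<Rightarrow> real^2 \<Rightarrow> real" where
  "dual_form \<alpha> \<beta> \<gamma> k = (\<gamma> * (k$1)\<^sup>2 - 2 * \<beta> * k$1 * k$2 + \<alpha> * (k$2)\<^sup>2) / (\<alpha> * \<gamma> - \<beta>\<^sup>2)"

lemma qform_dual_form_Cauchy_Schwarz:
  assumes "0 < \<alpha> * \<gamma> - \<beta>\<^sup>2"
  shows "(k \<bullet> w)\<^sup>2 \<le> qform \<alpha> \<beta> \<gamma> w * dual_form \<alpha> \<beta> \<gamma> k"
proof -
  let ?d = "\<alpha> * \<gamma> - \<beta>\<^sup>2"
  have "qform \<alpha> \<beta> \<gamma> w * (dual_form \<alpha> \<beta> \<gamma> k * ?d) - (k \<bullet> w)\<^sup>2 * ?d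
      = (k$2 * (\<alpha> * w$1 + \<beta> * w$2) - k$1 * (\<beta> * w$1 + \<gamma> * w$2))\<^sup>2"
    using assms by (simp add: dual_form_def qform_def inner_real2) algebra
  then have "(k \<bullet> w)\<^sup>2 * ?d \<le> qform \<alpha> \<beta> \<gamma> w * dual_form \<alpha> \<beta> \<gamma> k * ?d"
    by (smt (verit) mult.assoc zero_le_power2)
  then show ?thesis
    using assms by simp
qed

text \<open>The inverse matrix applied to \<open>k\<close>, hence the pole of the line \<open>k \<bullet> p = 1\<close>; if this line is
  tangent to the centred conic, it is the point of contact.\<close>

definition dual_point :: "real \<Rightarrow> real \<Rightarrow> real \<Rightarrow> real^2 \<Rightarrow> real^2" where
  "dual_point \<alpha> \<beta> \<gamma> k =
     (1 / (\<alpha> * \<gamma> - \<beta>\<^sup>2)) *\<^sub>R vector [\<gamma> * k$1 - \<beta> * k$2, \<alpha> * k$2 - \<beta> * k$1]"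

lemma inner_dual_point: "k \<bullet> dual_point \<alpha> \<beta> \<gamma> k = dual_form \<alpha> \<beta> \<gamma> k"
  by (simp add: dual_point_def dual_form_def inner_real2 power2_eq_square field_simps)
     (simp add: algebra_simps diff_divide_distrib add_divide_distrib)

lemma qform_scaleR: "qform \<alpha> \<beta> \<gamma> (r *\<^sub>R w) = r\<^sup>2 * qform \<alpha> \<beta> \<gamma> w"
  by (simp add: qform_def power2_eq_square algebra_simps)

lemma qform_dual_point:
  assumes "0 < \<alpha> * \<gamma> - \<beta>\<^sup>2"
  shows "qform \<alpha> \<beta> \<gamma> (dual_point \<alpha> \<beta> \<gamma> k) = dual_form \<alpha> \<beta> \<gamma> k"
proof -
  have "qform \<alpha> \<beta> \<gamma> (vector [\<gamma> * k$1 - \<beta> * k$2, \<alpha> * k$2 - \<beta> * k$1])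
      = (\<alpha> * \<gamma> - \<beta>\<^sup>2) * (\<gamma> * (k$1)\<^sup>2 - 2 * \<beta> * k$1 * k$2 + \<alpha> * (k$2)\<^sup>2)"
    by (simp add: qform_def power2_eq_square algebra_simps)
  then show ?thesis
    unfolding dual_point_def qform_scaleR dual_form_def using assms
    by (simp add: power2_eq_square[of "_ / _"])
qed

lemma dual_form_pos:
  assumes "0 < \<alpha>" "0 < \<alpha> * \<gamma> - \<beta>\<^sup>2" "k \<noteq> 0"
  shows "0 < dual_form \<alpha> \<beta> \<gamma> k"
proof -
  let ?d = "\<alpha> * \<gamma> - \<beta>\<^sup>2"
  have "\<alpha> * (\<gamma> * (k$1)\<^sup>2 - 2 * \<beta> * k$1 * k$2 + \<alpha> * (k$2)\<^sup>2)
      = (\<alpha> * k$2 - \<beta> * k$1)\<^sup>2 + ?d * (k$1)\<^sup>2"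
    by (simp add: power2_eq_square algebra_simps)
  moreover have "\<dots> > 0"
  proof (cases "k$1 = 0")
    case True
    then have "k$2 \<noteq> 0" using assms(3) by (auto simp: eq_real2_iff)
    then show ?thesis using True assms(1) by simp
  next
    case False
    then show ?thesis using assms(2) by (intro add_nonneg_pos) auto
  qed
  ultimately have "0 < \<gamma> * (k$1)\<^sup>2 - 2 * \<beta> * k$1 * k$2 + \<alpha> * (k$2)\<^sup>2"
    using assms(1) by (metis zero_less_mult_pos)
  then show ?thesis
    unfolding dual_form_def using assms(2) by (rule divide_pos_pos)
qed

text \<open>Reflecting the two contact points in \<open>c\<close> gives points of \<open>E\<close> with \<open>k \<bullet> p = 2 (k \<bullet> c) \<mp> 1\<close>.
  Both lie in the strip, which pins \<open>k \<bullet> c\<close> to \<open>0\<close>.  The maximum of \<open>k\<close> on \<open>E\<close> is then the square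
  root of the dual form, and the strip and the contact say that this maximum is \<open>1\<close>.\<close>

lemma conic_in_strip_touching:
  assumes E: "conic_ellipse E c \<alpha> \<beta> \<gamma>"
    and strip: "\<And>p. p \<in> E \<Longrightarrow> \<bar>k \<bullet> p\<bar> \<le> 1"
    and touch: "p \<in> E" "k \<bullet> p = 1" "p' \<in> E" "k \<bullet> p' = -1"
  shows "k \<bullet> c = 0" "dual_form \<alpha> \<beta> \<gamma> k = 1"
proof -
  have \<alpha>: "0 < \<alpha>" and d: "0 < \<alpha> * \<gamma> - \<beta>\<^sup>2" and mem: "\<And>w. c + w \<in> E \<longleftrightarrow> qform \<alpha> \<beta> \<gamma> w = 1"
    using E by (auto simp: conic_ellipse_def)
  show c: "k \<bullet> c = 0"
    using strip[OF conic_symmetric[OF E touch(1)]] strip[OF conic_symmetric[OF E touch(3)]] touch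
    by (simp add: inner_diff_right)
  define h where "h = dual_form \<alpha> \<beta> \<gamma> k"
  have "k \<noteq> 0" using touch by auto
  then have h: "h > 0"
    unfolding h_def by (intro dual_form_pos \<alpha> d)
  \<comment> \<open>The point of \<open>E\<close>, relative to its centre, at which \<open>k\<close> is largest.\<close>
  define w where "w = (1 / sqrt h) *\<^sub>R dual_point \<alpha> \<beta> \<gamma> k"
  have "qform \<alpha> \<beta> \<gamma> w = 1"
    using h by (simp add: w_def qform_scaleR qform_dual_point[OF d] power_divide flip: h_def)
  then have "\<bar>k \<bullet> (c + w)\<bar> \<le> 1"
    using mem strip by blast
  moreover have "k \<bullet> (c + w) = sqrt h"
    using h by (simp add: inner_add_right c w_def inner_dual_point real_div_sqrt flip: h_def)
  ultimately have "h \<le> 1"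
    using h by simp
  moreover have "(k \<bullet> (p - c))\<^sup>2 \<le> qform \<alpha> \<beta> \<gamma> (p - c) * h"
    unfolding h_def by (rule qform_dual_form_Cauchy_Schwarz[OF d])
  then have "1 \<le> h"
    using mem[of "p - c"] touch by (simp add: inner_diff_right c)
  ultimately show "dual_form \<alpha> \<beta> \<gamma> k = 1"
    by (simp add: h_def)
qed

text \<open>The curve is \<open>cos t p + sin t q\<close>, where \<open>p\<close> and \<open>q\<close> are conjugate: both lie on \<open>E\<close> and the
  polar form of \<open>q\<close> vanishes at the pair.  As \<open>k\<close> is the polar form of \<open>p\<close>, conjugacy says that
  \<open>q\<close> is parallel to the line \<open>k \<bullet> x = 1\<close>, and \<open>q\<close> is the velocity at \<open>t = 0\<close>.\<close>

lemma conic_tangent_line: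
  assumes E: "conic_ellipse E 0 \<alpha> \<beta> \<gamma>" and k: "dual_form \<alpha> \<beta> \<gamma> k = 1"
  shows "tangent_line_at E (dual_point \<alpha> \<beta> \<gamma> k) {x. k \<bullet> x = 1}"
proof -
  have d: "0 < \<alpha> * \<gamma> - \<beta>\<^sup>2" and E_eq: "E = {p. qform \<alpha> \<beta> \<gamma> p = 1}"
    using E by (auto simp: conic_ellipse_def)
  define p where "p = dual_point \<alpha> \<beta> \<gamma> k"
  define r where "r = 1 / (\<alpha> * \<gamma> - \<beta>\<^sup>2)"
  have r: "r * (\<alpha> * \<gamma> - \<beta>\<^sup>2) = 1" "r > 0"
    using d by (simp_all add: r_def)
  have p1: "p$1 = r * (\<gamma> * k$1 - \<beta> * k$2)" and p2: "p$2 = r * (\<alpha> * k$2 - \<beta> * k$1)"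
    by (simp_all add: p_def dual_point_def r_def)
  have k1: "\<alpha> * p$1 + \<beta> * p$2 = k$1" and k2: "\<beta> * p$1 + \<gamma> * p$2 = k$2"
  proof -
    have "\<alpha> * p$1 + \<beta> * p$2 = r * (\<alpha> * \<gamma> - \<beta>\<^sup>2) * k$1"
      "\<beta> * p$1 + \<gamma> * p$2 = r * (\<alpha> * \<gamma> - \<beta>\<^sup>2) * k$2"
      by (simp_all add: p1 p2 power2_eq_square algebra_simps)
    then show "\<alpha> * p$1 + \<beta> * p$2 = k$1" "\<beta> * p$1 + \<gamma> * p$2 = k$2"
      using r(1) by simp_all
  qed
  have kp: "k \<bullet> p = 1"
    by (simp add: p_def inner_dual_point k)
  have qp: "qform \<alpha> \<beta> \<gamma> p = 1"
    by (simp add: p_def qform_dual_point[OF d] k)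
  define q :: "real^2" where "q = sqrt r *\<^sub>R vector [- k$2, k$1]"
  have q1: "q$1 = - sqrt r * k$2" and q2: "q$2 = sqrt r * k$1"
    by (simp_all add: q_def)
  have kq: "k \<bullet> q = 0"
    by (simp add: inner_real2 q1 q2)
  have "qform \<alpha> \<beta> \<gamma> q = dual_form \<alpha> \<beta> \<gamma> k"
  proof -
    have "qform \<alpha> \<beta> \<gamma> q = r * (\<gamma> * (k$1)\<^sup>2 - 2 * \<beta> * k$1 * k$2 + \<alpha> * (k$2)\<^sup>2)"
      unfolding q_def qform_scaleR using r(2) by (simp add: qform_def)
    then show ?thesis
      by (simp add: dual_form_def r_def)
  qed
  then have qq: "qform \<alpha> \<beta> \<gamma> q = 1"
    using k by simp
  define g where "g = (\<lambda>t. cos t *\<^sub>R p + sin t *\<^sub>R q)"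
  have "qform \<alpha> \<beta> \<gamma> (g t) = 1" for t
  proof -
    have "qform \<alpha> \<beta> \<gamma> (g t) = (cos t)\<^sup>2 * qform \<alpha> \<beta> \<gamma> p
        + 2 * cos t * sin t * ((\<alpha> * p$1 + \<beta> * p$2) * q$1 + (\<beta> * p$1 + \<gamma> * p$2) * q$2)
        + (sin t)\<^sup>2 * qform \<alpha> \<beta> \<gamma> q"
      by (simp add: g_def qform_def power2_eq_square algebra_simps)
    also have "\<dots> = 1"
      using kq unfolding k1 k2 qp qq inner_real2 by simp
    finally show ?thesis .
  qed
  then have "range g \<subseteq> E"
    by (auto simp: E_eq)
  moreover have "g 0 = p"
    by (simp add: g_def)
  moreover have "(g has_vector_derivative q) (at 0)"
    unfolding g_def by (auto intro!: derivative_eq_intros)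
  moreover have "q \<noteq> 0"
    using qq by (auto simp: qform_def)
  moreover have "{x. k \<bullet> x = 1} = {p + t *\<^sub>R q | t. True}"
  proof (intro subset_antisym subsetI)
    fix x assume "x \<in> {p + t *\<^sub>R q | t. True}"
    then show "x \<in> {x. k \<bullet> x = 1}"
      by (auto simp: inner_add_right kp kq)
  next
    fix x assume "x \<in> {x. k \<bullet> x = 1}"
    then have x: "k$1 * (x$1 - p$1) + k$2 * (x$2 - p$2) = 0"
      using kp by (simp add: inner_real2 algebra_simps)
    define N where "N = k$1 * k$1 + k$2 * k$2"
    have "k \<noteq> 0" using kp by auto
    then have N: "N > 0"
      unfolding N_def by (metis inner_gt_zero_iff inner_real2)
    \<comment> \<open>Up to a positive factor, \<open>j\<close> is the component of \<open>x - p\<close> along \<open>q\<close>.\<close>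
    define j where "j = k$1 * (x$2 - p$2) - k$2 * (x$1 - p$1)"
    have "N * (x$1 - p$1) = - k$2 * j" "N * (x$2 - p$2) = k$1 * j"
    proof -
      have "N * (x$1 - p$1) + k$2 * j = k$1 * (k$1 * (x$1 - p$1) + k$2 * (x$2 - p$2))"
        "N * (x$2 - p$2) - k$1 * j = k$2 * (k$1 * (x$1 - p$1) + k$2 * (x$2 - p$2))"
        by (simp_all add: N_def j_def algebra_simps)
      then show "N * (x$1 - p$1) = - k$2 * j" "N * (x$2 - p$2) = k$1 * j"
        unfolding x by simp_all
    qed
    then have "x$1 - p$1 = - k$2 * j / N" "x$2 - p$2 = k$1 * j / N"
      using N by (metis less_irrefl nonzero_mult_div_cancel_left)+
    then have "x = p + (j / (N * sqrt r)) *\<^sub>R q"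
      using r(2) unfolding eq_real2_iff by (simp add: q1 q2 algebra_simps)
    then show "x \<in> {p + t *\<^sub>R q | t. True}"
      by blast
  qed
  ultimately show ?thesis
    unfolding tangent_line_at_def p_def[symmetric] by blast
qed

section \<open>Sides and vertices of a parallelogram\<close>

text \<open>A supporting line meets \<open>R\<close> in a face; two points in common with \<open>R\<close> make this face
  one-dimensional, so it spans the line.\<close>

lemma planar_supporting_line_edge:
  fixes R :: "(real^2) set"
  assumes "convex R" and le: "\<And>x. x \<in> R \<Longrightarrow> k \<bullet> x \<le> 1"
    and xy: "x \<in> R" "y \<in> R" "x \<noteq> y" "k \<bullet> x = 1" "k \<bullet> y = 1"
  shows "(R \<inter> {p. k \<bullet> p = 1}) edge_of R" "affine hull (R \<inter> {p. k \<bullet> p = 1}) = {p. k \<bullet> p = 1}"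
proof -
  let ?s = "R \<inter> {p. k \<bullet> p = 1}" and ?L = "{p. k \<bullet> p = 1}"
  have "k \<noteq> 0" using xy by auto
  then have L: "aff_dim ?L = 1"
    by (simp add: aff_dim_hyperplane)
  have "aff_dim {x, y} \<le> aff_dim ?s"
    using xy by (intro aff_dim_subset) auto
  moreover have "aff_dim ?s \<le> aff_dim ?L"
    by (intro aff_dim_subset) auto
  ultimately have dim: "aff_dim ?s = 1"
    using L xy by simp
  moreover have "?s face_of R"
    using assms by (intro face_of_Int_supporting_hyperplane_le)
  ultimately show "?s edge_of R"
    by (simp add: edge_of_def)
  show "affine hull ?s = ?L"
  proof (rule affine_dim_equal)
    show "affine hull ?s \<subseteq> ?L"
      by (rule hull_minimal) (auto simp: affine_hyperplane)
    show "affine hull ?s \<noteq> {}"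
      using xy by (metis (mono_tags, lifting) Int_iff affine_hull_eq_empty empty_iff mem_Collect_eq)
  qed (use dim L in \<open>auto simp: affine_hyperplane\<close>)
qed

text \<open>An edge is a proper face, so none of its points is interior to \<open>R\<close>.  A relative interior point
  of it therefore lies on one of the given supporting lines, and the face cut out by this line then
  contains the whole edge.  Two edges one of which is a face of the other coincide, having the same
  dimension.\<close>

lemma planar_edge_on_supporting_line:
  fixes R :: "(real^2) set"
  assumes "convex R" "s edge_of R"
    and K: "\<And>k. k \<in> K \<Longrightarrow> (R \<inter> {p. k \<bullet> p = 1}) edge_of R"
    and interior: "\<And>p. p \<in> R \<Longrightarrow> (\<And>k. k \<in> K \<Longrightarrow> k \<bullet> p \<noteq> 1) \<Longrightarrow> p \<in> interior R"
  obtains k where "k \<in> K" "s = R \<inter> {p. k \<bullet> p = 1}"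
proof -
  have s: "s face_of R" "aff_dim s = 1"
    using assms(2) by (auto simp: edge_of_def)
  have sub: "s \<subseteq> R" and cs: "convex s"
    using s face_of_imp_subset face_of_imp_convex by blast+
  have "s \<noteq> {}" using s by auto
  then obtain x where x: "x \<in> rel_interior s"
    using cs rel_interior_eq_empty by blast
  then have xs: "x \<in> s"
    using rel_interior_subset by blast
  have "x \<notin> interior R"
  proof (cases "s = R")
    case True
    then show ?thesis
      using s(2) aff_dim_nonempty_interior[of R] by auto
  next
    case False
    then show ?thesis
      using face_of_disjoint_interior[OF s(1)] xs by blast
  qed
  then obtain k where k: "k \<in> K" "k \<bullet> x = 1"
    using interior sub xs by blast
  let ?t = "R \<inter> {p. k \<bullet> p = 1}"
  have t: "?t face_of R" "aff_dim ?t = 1"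
    using K[OF k(1)] by (auto simp: edge_of_def)
  have st: "s \<subseteq> ?t"
    by (rule subset_of_face_of[OF t(1) sub]) (use x xs sub k in blast)
  have "s face_of ?t"
    using s(1) st by (meson face_of_subset inf_le1)
  then have "s = ?t"
    using face_of_aff_dim_lt[of ?t s] face_of_imp_convex[OF t(1)] s t by fastforce
  with k that show thesis by blast
qed

text \<open>A parallelogram is handled through the dual basis \<open>m\<close>, \<open>n\<close> of its half sides \<open>e\<close>, \<open>f\<close>: it is
  the square of side \<open>2\<close> around \<open>0\<close> in the coordinates \<open>m \<bullet> p\<close> and \<open>n \<bullet> p\<close>, and its sides lie on
  the lines where \<open>m\<close>, \<open>- m\<close>, \<open>n\<close> or \<open>- n\<close> takes the value \<open>1\<close>.\<close>

locale dual_frame =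
  fixes m n e f :: "real^2"
  assumes dual: "m \<bullet> e = 1" "m \<bullet> f = 0" "n \<bullet> e = 0" "n \<bullet> f = 1"
    and expand: "\<And>p. p = (m \<bullet> p) *\<^sub>R e + (n \<bullet> p) *\<^sub>R f"
begin

definition parallelogram :: "(real^2) set" where
  "parallelogram = {p. \<bar>m \<bullet> p\<bar> \<le> 1 \<and> \<bar>n \<bullet> p\<bar> \<le> 1}"

abbreviation side_forms :: "(real^2) set" where
  "side_forms \<equiv> {m, - m, n, - n}"

lemma point_eq_iff: "p = q \<longleftrightarrow> m \<bullet> p = m \<bullet> q \<and> n \<bullet> p = n \<bullet> q"
  using expand[of p] expand[of q] by metis

lemma parallelogram_eq: "parallelogram = (\<Inter>k\<in>side_forms. {p. k \<bullet> p \<le> 1})"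
  by (auto simp: parallelogram_def abs_le_iff)

lemma polytope_parallelogram: "polytope parallelogram"
proof -
  have "polyhedron parallelogram"
    unfolding parallelogram_eq 
    by (intro polyhedron_Inter) (auto simp only: finite.intros finite_imageI polyhedron_halfspace_le)
  moreover have "norm p \<le> norm e + norm f" if "p \<in> parallelogram" for p
  proof -
    have "norm p \<le> \<bar>m \<bullet> p\<bar> * norm e + \<bar>n \<bullet> p\<bar> * norm f"
      using expand[of p] by (metis norm_scaleR norm_triangle_ineq)
    also have "\<dots> \<le> 1 * norm e + 1 * norm f"
      using that by (intro add_mono mult_right_mono) (auto simp: parallelogram_def)
    finally show ?thesis by simp
  qed
  then have "bounded parallelogram"
    by (auto simp: bounded_iff)
  ultimately show ?thesis
    by (simp add: polytope_eq_bounded_polyhedron)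
qed

lemma convex_parallelogram: "convex parallelogram"
  using polytope_parallelogram polytope_imp_convex by blast

lemma side:
  assumes "k \<in> side_forms"
  shows "(parallelogram \<inter> {p. k \<bullet> p = 1}) edge_of parallelogram"
    and "affine hull (parallelogram \<inter> {p. k \<bullet> p = 1}) = {p. k \<bullet> p = 1}"
proof -
  have "k \<bullet> x \<le> 1" if "x \<in> parallelogram" for x
    using that assms by (auto simp: parallelogram_def)
  moreover obtain x y where "x \<in> parallelogram" "y \<in> parallelogram" "x \<noteq> y" "k \<bullet> x = 1" "k \<bullet> y = 1"
  proof -
    have "e + f \<noteq> e - f" "e + f \<noteq> - e + f" "e - f \<noteq> - e - f" "- e + f \<noteq> - e - f"
      by (simp_all add: point_eq_iff inner_simps dual)
    moreover have "{e + f, e - f, - e + f, - e - f} \<subseteq> parallelogram"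
      by (simp add: parallelogram_def inner_simps dual)
    ultimately show thesis
      using assms that by (auto simp: inner_simps dual)
  qed
  ultimately show "(parallelogram \<inter> {p. k \<bullet> p = 1}) edge_of parallelogram"
    "affine hull (parallelogram \<inter> {p. k \<bullet> p = 1}) = {p. k \<bullet> p = 1}"
    using planar_supporting_line_edge[OF convex_parallelogram] by blast+
qed

lemma edge_of_parallelogramE:
  assumes "s edge_of parallelogram"
  obtains k where "k \<in> side_forms" "s = parallelogram \<inter> {p. k \<bullet> p = 1}"
proof (rule planar_edge_on_supporting_line[OF convex_parallelogram assms, where K = side_forms])
  fix p assume p: "p \<in> parallelogram" "\<And>k. k \<in> side_forms \<Longrightarrow> k \<bullet> p \<noteq> 1"
  let ?U = "(\<Inter>k\<in>side_forms. {p. k \<bullet> p < 1})"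
  have "open ?U"
    by (intro open_INT ballI open_halfspace_lt) simp
  moreover have "?U \<subseteq> parallelogram"
    by (auto simp: parallelogram_eq)
  moreover have "p \<in> ?U"
    using p by (force simp: parallelogram_eq)
  ultimately show "p \<in> interior parallelogram"
    by (meson interiorI)
qed (use side(1) that in auto)

text \<open>A point with \<open>|m \<bullet> p| < 1\<close> can be moved both ways along \<open>e\<close>, one with \<open>|n \<bullet> p| < 1\<close> both ways
  along \<open>f\<close>; neither is extreme.  Each of the four remaining points is the intersection of two sides,
  hence a face.\<close>

lemma vertices_parallelogram: "vertices parallelogram = {e + f, e - f, - e + f, - e - f}"
proof -
  have not_extreme: "\<not> p extreme_point_of parallelogram"
    if "p + z \<in> parallelogram" "p - z \<in> parallelogram" "z \<noteq> 0" for p z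
  proof
    assume "p extreme_point_of parallelogram"
    moreover have "p \<in> open_segment (p + z) (p - z)"
    proof -
      have "p + z \<noteq> p - z"
        using that(3) by (metis add_uminus_conv_diff add_left_cancel eq_neg_iff_add_eq_0 scaleR_2
            scaleR_eq_0_iff zero_neq_numeral)
      moreover have "midpoint (p + z) (p - z) = p"
        by (simp add: midpoint_def scaleR_2 flip: scaleR_add_right)
      ultimately show ?thesis
        by (metis midpoint_in_open_segment)
    qed
    ultimately show False
      using that by (auto simp: extreme_point_of_def)
  qed
  have extreme: "p extreme_point_of parallelogram \<longleftrightarrow> \<bar>m \<bullet> p\<bar> = 1 \<and> \<bar>n \<bullet> p\<bar> = 1" for p
  proof
    assume ext: "p extreme_point_of parallelogram"
    then have p: "\<bar>m \<bullet> p\<bar> \<le> 1" "\<bar>n \<bullet> p\<bar> \<le> 1"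
      by (auto simp: extreme_point_of_def parallelogram_def)
    have nz: "e \<noteq> 0" "f \<noteq> 0" using dual by auto
    have "\<bar>m \<bullet> p\<bar> = 1"
    proof (rule ccontr)
      assume "\<not> ?thesis"
      then have "p + (1 - \<bar>m \<bullet> p\<bar>) *\<^sub>R e \<in> parallelogram" "p - (1 - \<bar>m \<bullet> p\<bar>) *\<^sub>R e \<in> parallelogram"
        "(1 - \<bar>m \<bullet> p\<bar>) *\<^sub>R e \<noteq> 0"
        using p nz by (auto simp: parallelogram_def inner_simps dual)
      with not_extreme ext show False by blast
    qed
    moreover have "\<bar>n \<bullet> p\<bar> = 1"
    proof (rule ccontr)
      assume "\<not> ?thesis"
      then have "p + (1 - \<bar>n \<bullet> p\<bar>) *\<^sub>R f \<in> parallelogram" "p - (1 - \<bar>n \<bullet> p\<bar>) *\<^sub>R f \<in> parallelogram"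
        "(1 - \<bar>n \<bullet> p\<bar>) *\<^sub>R f \<noteq> 0"
        using p nz by (auto simp: parallelogram_def inner_simps dual)
      with not_extreme ext show False by blast
    qed
    ultimately show "\<bar>m \<bullet> p\<bar> = 1 \<and> \<bar>n \<bullet> p\<bar> = 1" by simp
  next
    assume p: "\<bar>m \<bullet> p\<bar> = 1 \<and> \<bar>n \<bullet> p\<bar> = 1"
    then have "m \<bullet> p = 1 \<or> - m \<bullet> p = 1" "n \<bullet> p = 1 \<or> - n \<bullet> p = 1"
      unfolding inner_minus_left by linarith+
    then obtain k l where kl: "k \<in> {m, - m}" "l \<in> {n, - n}" "k \<bullet> p = 1" "l \<bullet> p = 1"
      by blast
    have "parallelogram \<inter> {p. k \<bullet> p = 1} \<inter> (parallelogram \<inter> {p. l \<bullet> p = 1}) = {p}"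
    proof -
      have "q = p" if "k \<bullet> q = 1" "l \<bullet> q = 1" for q
      proof -
        have "m \<bullet> q = m \<bullet> p" "n \<bullet> q = n \<bullet> p"
          using kl that by auto
        then show ?thesis by (simp add: point_eq_iff[of q p])
      qed
      moreover have "p \<in> parallelogram"
        using p by (simp add: parallelogram_def)
      ultimately show ?thesis
        using kl(3,4) by blast
    qed
    then have "{p} face_of parallelogram"
      using face_of_Int[of "parallelogram \<inter> {p. k \<bullet> p = 1}" parallelogram "parallelogram \<inter> {p. l \<bullet> p = 1}"]
        side(1)[of k] side(1)[of l] kl by (auto simp: edge_of_def)
    then show "p extreme_point_of parallelogram"
      by (simp add: face_of_singleton)
  qed
  have "p \<in> {e + f, e - f, - e + f, - e - f} \<longleftrightarrow> \<bar>m \<bullet> p\<bar> = 1 \<and> \<bar>n \<bullet> p\<bar> = 1" for p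
    unfolding insert_iff empty_iff point_eq_iff[of p] by (auto simp: inner_simps dual)
  then show ?thesis
    unfolding vertices_def extreme by blast
qed

lemma trapezoid_parallelogram: "trapezoid parallelogram"
proof -
  have "card (vertices parallelogram) = 4"
    unfolding vertices_parallelogram by (subst card_insert_disjoint | simp add: point_eq_iff inner_simps dual)+
  then have "convex_quadrilateral parallelogram"
    by (simp add: convex_quadrilateral_def polytope_parallelogram)
  moreover have "{p. - m \<bullet> p = 1} = (+) (- 2 *\<^sub>R e) ` {p. m \<bullet> p = 1}"
  proof (intro subset_antisym subsetI)
    fix p assume "p \<in> {p. - m \<bullet> p = 1}"
    then have "p + 2 *\<^sub>R e \<in> {p. m \<bullet> p = 1}"
      by (simp add: inner_simps dual)
    then show "p \<in> (+) (- 2 *\<^sub>R e) ` {p. m \<bullet> p = 1}"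
      by (rule rev_image_eqI) simp
  qed (auto simp: inner_simps dual)
  then have "affine_parallel {p. m \<bullet> p = 1} {p. - m \<bullet> p = 1}"
    unfolding affine_parallel_def by blast
  moreover have "{p. m \<bullet> p = 1} \<noteq> {p. - m \<bullet> p = 1}"
    using dual(1) by (auto simp: set_eq_iff)
  then have "parallelogram \<inter> {p. m \<bullet> p = 1} \<noteq> parallelogram \<inter> {p. - m \<bullet> p = 1}"
    using side(2)[of m] side(2)[of "- m"] by (metis insertI1 insertI2)
  ultimately show ?thesis
    unfolding trapezoid_def using side[of m] side[of "- m"] by (metis insertI1 insertI2)
qed

text \<open>The contact with two opposite sides places \<open>E\<close> in a strip whose boundary lines it touches, for
  each of the two pairs of sides.  Conversely the poles of the four side lines are contact points; they
  lie on the sides themselves, and not just on their extensions, because \<open>E\<close> stays inside the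
  parallelogram.\<close>

lemma inscribed_parallelogram_iff:
  assumes E: "conic_ellipse E c \<alpha> \<beta> \<gamma>"
  shows "inscribed E parallelogram \<longleftrightarrow>
    c = 0 \<and> dual_form \<alpha> \<beta> \<gamma> m = 1 \<and> dual_form \<alpha> \<beta> \<gamma> n = 1"
proof
  assume ins: "inscribed E parallelogram"
  then have sub: "E \<subseteq> parallelogram"
    by (simp add: inscribed_def)
  have touch: "\<exists>p\<in>E. k \<bullet> p = 1" if k: "k \<in> side_forms" for k
  proof -
    obtain p where "p \<in> parallelogram \<inter> {p. k \<bullet> p = 1}"
      "tangent_line_at E p (affine hull (parallelogram \<inter> {p. k \<bullet> p = 1}))"
      using ins side(1)[OF k] unfolding inscribed_def by blast
    then show ?thesis
      unfolding tangent_line_at_def by blast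
  qed
  have "k \<bullet> c = 0 \<and> dual_form \<alpha> \<beta> \<gamma> k = 1" if k: "k \<in> {m, n}" for k
  proof -
    obtain p p' where "p \<in> E" "k \<bullet> p = 1" "p' \<in> E" "- k \<bullet> p' = 1"
      using touch[of k] touch[of "- k"] k by blast
    moreover have "\<bar>k \<bullet> q\<bar> \<le> 1" if "q \<in> E" for q
      using that sub k by (auto simp: parallelogram_def)
    ultimately show ?thesis
      using conic_in_strip_touching[OF E, of k p p'] by simp
  qed
  then show "c = 0 \<and> dual_form \<alpha> \<beta> \<gamma> m = 1 \<and> dual_form \<alpha> \<beta> \<gamma> n = 1"
    by (simp add: point_eq_iff)
next
  assume *: "c = 0 \<and> dual_form \<alpha> \<beta> \<gamma> m = 1 \<and> dual_form \<alpha> \<beta> \<gamma> n = 1"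
  then have E0: "conic_ellipse E 0 \<alpha> \<beta> \<gamma>" and d: "0 < \<alpha> * \<gamma> - \<beta>\<^sup>2"
    and E_eq: "E = {p. qform \<alpha> \<beta> \<gamma> p = 1}"
    using E by (auto simp: conic_ellipse_def)
  have "dual_form \<alpha> \<beta> \<gamma> (- k) = dual_form \<alpha> \<beta> \<gamma> k" for k
    by (simp add: dual_form_def)
  then have dual1: "dual_form \<alpha> \<beta> \<gamma> k = 1" if "k \<in> side_forms" for k
    using that * by auto
  have sub: "E \<subseteq> parallelogram"
  proof
    fix p assume "p \<in> E"
    then have "(k \<bullet> p)\<^sup>2 \<le> 1" if "k \<in> side_forms" for k
      using qform_dual_form_Cauchy_Schwarz[OF d, of k p] dual1[OF that] by (simp add: E_eq)
    then show "p \<in> parallelogram"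
      by (simp add: parallelogram_def abs_square_le_1)
  qed
  show "inscribed E parallelogram"
    unfolding inscribed_def
  proof (intro conjI allI impI)
    show "ellipse E" by (rule conic_imp_ellipse[OF E])
    show "E \<subseteq> parallelogram" by (rule sub)
    fix s assume "s edge_of parallelogram"
    then obtain k where k: "k \<in> side_forms" "s = parallelogram \<inter> {p. k \<bullet> p = 1}"
      by (rule edge_of_parallelogramE)
    let ?p = "dual_point \<alpha> \<beta> \<gamma> k"
    have "qform \<alpha> \<beta> \<gamma> ?p = 1" "k \<bullet> ?p = 1"
      using dual1[OF k(1)] by (simp_all add: qform_dual_point[OF d] inner_dual_point)
    then have "?p \<in> s"
      using sub k by (auto simp: E_eq)
    moreover have "tangent_line_at E ?p (affine hull s)"
      using conic_tangent_line[OF E0 dual1[OF k(1)]] side(2)[OF k(1)] k(2) by simp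
    ultimately show "\<exists>p\<in>s. tangent_line_at E p (affine hull s)" by blast
  qed
qed

text \<open>If \<open>E\<close> contains \<open>w\<close> and \<open>- w\<close>, then its form takes the same value at \<open>w + c\<close> and at \<open>w - c\<close>,
  so its polar form vanishes at \<open>(w, c)\<close>.  For \<open>w = e + f\<close> and \<open>w = e - f\<close> this leaves only \<open>c = 0\<close>.\<close>

lemma circumscribed_parallelogram_iff:
  assumes E: "conic_ellipse E c \<alpha> \<beta> \<gamma>"
  shows "circumscribed E parallelogram \<longleftrightarrow>
    c = 0 \<and> qform \<alpha> \<beta> \<gamma> (e + f) = 1 \<and> qform \<alpha> \<beta> \<gamma> (e - f) = 1"
proof -
  have \<alpha>: "0 < \<alpha>" and d: "0 < \<alpha> * \<gamma> - \<beta>\<^sup>2" and E_eq: "E = {p. qform \<alpha> \<beta> \<gamma> (p - c) = 1}"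
    using E by (auto simp: conic_ellipse_def)
  have neg: "qform \<alpha> \<beta> \<gamma> (- w) = qform \<alpha> \<beta> \<gamma> w" for w
    by (simp add: qform_def)
  have mem: "circumscribed E parallelogram \<longleftrightarrow> qform \<alpha> \<beta> \<gamma> (e + f - c) = 1 \<and> qform \<alpha> \<beta> \<gamma> (e - f - c) = 1
      \<and> qform \<alpha> \<beta> \<gamma> (e + f + c) = 1 \<and> qform \<alpha> \<beta> \<gamma> (e - f + c) = 1"
  proof -
    have "- e - f - c = - (e + f + c)" "- e + f - c = - (e - f + c)"
      by simp_all
    then have "qform \<alpha> \<beta> \<gamma> (- e - f - c) = qform \<alpha> \<beta> \<gamma> (e + f + c)"
      "qform \<alpha> \<beta> \<gamma> (- e + f - c) = qform \<alpha> \<beta> \<gamma> (e - f + c)"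
      by (metis neg)+
    then show ?thesis
      using conic_imp_ellipse[OF E]
      unfolding circumscribed_def vertices_parallelogram E_eq by auto
  qed
  have "c = 0" if "circumscribed E parallelogram"
  proof -
    \<comment> \<open>The polar form of \<open>c\<close>, as a vector.\<close>
    define l :: "real^2" where "l = vector [\<alpha> * c$1 + \<beta> * c$2, \<beta> * c$1 + \<gamma> * c$2]"
    have polar: "qform \<alpha> \<beta> \<gamma> (w + c) - qform \<alpha> \<beta> \<gamma> (w - c) = 4 * (l \<bullet> w)" for w
      by (simp add: l_def inner_real2 qform_def power2_eq_square algebra_simps)
    have "l \<bullet> (e + f) = 0" "l \<bullet> (e - f) = 0"
      using polar[of "e + f"] polar[of "e - f"] that unfolding mem by simp_all
    then have "l \<bullet> e = 0" "l \<bullet> f = 0"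
      by (simp_all add: inner_simps)
    then have "l \<bullet> l = 0"
      using expand[of l] by (metis add.right_neutral inner_add_right inner_scaleR_right mult_zero_right)
    then have "\<alpha> * c$1 + \<beta> * c$2 = 0" "\<beta> * c$1 + \<gamma> * c$2 = 0"
      by (auto simp: l_def eq_real2_iff)
    then have "(\<alpha> * \<gamma> - \<beta>\<^sup>2) * c$1 = 0" "(\<alpha> * \<gamma> - \<beta>\<^sup>2) * c$2 = 0"
      by algebra+
    then show "c = 0"
      using d by (simp add: eq_real2_iff)
  qed
  then show ?thesis
    using mem by auto
qed

end

section \<open>The minimal ellipses\<close>

text \<open>The coefficients and the centre of a conic determine it, so an ellipse other than \<open>E\<close> must
  fall into the case of strict inequality.\<close>

lemma unique_min_eccentricityI:
  assumes E: "conic_ellipse E 0 \<alpha> \<beta> \<gamma>" and "P E"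
    and ellipse: "\<And>E'. P E' \<Longrightarrow> ellipse E'"
    and min: "\<And>E' c' \<alpha>' \<beta>' \<gamma>'. P E' \<Longrightarrow> conic_ellipse E' c' \<alpha>' \<beta>' \<gamma>' \<Longrightarrow>
      c' = 0 \<and> ((\<alpha>', \<beta>', \<gamma>') = (\<alpha>, \<beta>, \<gamma>) \<or>
        (\<alpha> + \<gamma>)\<^sup>2 / (\<alpha> * \<gamma> - \<beta>\<^sup>2) < (\<alpha>' + \<gamma>')\<^sup>2 / (\<alpha>' * \<gamma>' - \<beta>'\<^sup>2))"
  shows "unique_min_eccentricity P E"
  unfolding unique_min_eccentricity_def
proof (intro conjI allI impI)
  show "P E" by fact
  fix E' assume E': "P E' \<and> E' \<noteq> E"
  then obtain c' \<alpha>' \<beta>' \<gamma>' where conic: "conic_ellipse E' c' \<alpha>' \<beta>' \<gamma>'"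
    using ellipse ellipse_imp_conic by meson
  with E' E have "\<not> (c' = 0 \<and> (\<alpha>', \<beta>', \<gamma>') = (\<alpha>, \<beta>, \<gamma>))"
    by (auto simp: conic_ellipse_def)
  then show "eccentricity E < eccentricity E'"
    using min[OF _ conic] E' eccentricity_less_conic_iff[OF E conic] by blast
qed

theorem theorem5:
  shows "\<exists>(R :: (real^2) set) (\<tau> :: real). \<tau> > 0 \<and> trapezoid R \<and> bielliptic_of_class R \<tau>"
proof -
  define m n e f :: "real^2"
    where "m = vector [0, 1]" and "n = vector [1, -2]" and "e = vector [2, 1]" and "f = vector [1, 0]"
  note frame_defs = m_def n_def e_def f_def
  interpret dual_frame m n e f
    by unfold_locales (simp_all add: frame_defs inner_real2 eq_real2_iff)
  let ?R = parallelogram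
  \<comment> \<open>The coefficients are those that make the squares in the two minimizations below vanish.\<close>
  define EI where "EI = {p. qform (9/5) (-12/5) (21/5) (p - 0) = 1}"
  define EO where "EO = {p. qform (1/6) (-1/3) (3/2) (p - 0) = 1}"
  have EI: "conic_ellipse EI 0 (9/5) (-12/5) (21/5)"
    by (simp add: conic_ellipse_def EI_def power2_eq_square)
  have EO: "conic_ellipse EO 0 (1/6) (-1/3) (3/2)"
    by (simp add: conic_ellipse_def EO_def power2_eq_square)
  have min_I: "unique_min_eccentricity (\<lambda>E. inscribed E ?R) EI"
  proof (rule unique_min_eccentricityI[OF EI])
    show "inscribed EI ?R"
      unfolding inscribed_parallelogram_iff[OF EI]
      by (simp add: dual_form_def frame_defs power2_eq_square)
    fix E c \<alpha> \<beta> \<gamma>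
    assume ins: "inscribed E ?R" and E: "conic_ellipse E c \<alpha> \<beta> \<gamma>"
    then have c: "c = 0" and dual1: "dual_form \<alpha> \<beta> \<gamma> m = 1" "dual_form \<alpha> \<beta> \<gamma> n = 1"
      by (simp_all add: inscribed_parallelogram_iff[OF E])
    define d where "d = \<alpha> * \<gamma> - \<beta>\<^sup>2"
    have d: "d > 0"
      using E by (simp add: conic_ellipse_def d_def)
    have \<alpha>: "\<alpha> = d" and \<gamma>: "\<gamma> = - 3 * d - 4 * \<beta>"
      using dual1 d unfolding dual_form_def frame_defs d_def[symmetric] by simp_all
    \<comment> \<open>The definition of the determinant, as a relation between the two remaining unknowns.\<close>
    have quad: "\<beta>\<^sup>2 + 4 * d * \<beta> + 3 * d\<^sup>2 + d = 0"
      using d_def unfolding \<alpha> \<gamma> by algebra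
    have sq: "(\<alpha> + \<gamma>)\<^sup>2 = 20 * d + (8 * d + 6 * \<beta>)\<^sup>2"
      using quad unfolding \<alpha> \<gamma> by algebra
    show "c = 0 \<and> ((\<alpha>, \<beta>, \<gamma>) = (9/5, -12/5, 21/5) \<or>
        (9/5 + 21/5)\<^sup>2 / (9/5 * (21/5) - (-12/5)\<^sup>2) < (\<alpha> + \<gamma>)\<^sup>2 / (\<alpha> * \<gamma> - \<beta>\<^sup>2))"
    proof (cases "8 * d + 6 * \<beta> = 0")
      case True
      then have \<beta>: "\<beta> = - 4 / 3 * d" by simp
      have "d * (9 - 5 * d) = 0"
        using quad unfolding \<beta> by (simp add: power2_eq_square algebra_simps)
      then have "d = 9 / 5" using d by simp
      then show ?thesis using c \<alpha> \<beta> \<gamma> by simp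
    next
      case False
      then have "20 * d < (\<alpha> + \<gamma>)\<^sup>2" unfolding sq by simp
      then show ?thesis using c d unfolding d_def[symmetric]
        by (simp add: power2_eq_square less_divide_eq)
    qed
  qed (simp add: inscribed_def)
  have min_O: "unique_min_eccentricity (\<lambda>E. circumscribed E ?R) EO"
  proof (rule unique_min_eccentricityI[OF EO])
    show "circumscribed EO ?R"
      unfolding circumscribed_parallelogram_iff[OF EO]
      by (simp add: qform_def frame_defs power2_eq_square)
    fix E c \<alpha> \<beta> \<gamma>
    assume circ: "circumscribed E ?R" and E: "conic_ellipse E c \<alpha> \<beta> \<gamma>"
    then have c: "c = 0" and q: "9 * \<alpha> + 6 * \<beta> + \<gamma> = 1" "\<alpha> + 2 * \<beta> + \<gamma> = 1"
      using circumscribed_parallelogram_iff[OF E] by (simp_all add: qform_def frame_defs)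
    have \<beta>: "\<beta> = - 2 * \<alpha>" and \<gamma>: "\<gamma> = 1 + 3 * \<alpha>"
      using q by simp_all
    have d: "\<alpha> * \<gamma> - \<beta>\<^sup>2 > 0"
      using E by (simp add: conic_ellipse_def)
    have sq: "(\<alpha> + \<gamma>)\<^sup>2 = 20 * (\<alpha> * \<gamma> - \<beta>\<^sup>2) + (6 * \<alpha> - 1)\<^sup>2"
      unfolding \<beta> \<gamma> by (simp add: power2_eq_square algebra_simps)
    show "c = 0 \<and> ((\<alpha>, \<beta>, \<gamma>) = (1/6, -1/3, 3/2) \<or>
        (1/6 + 3/2)\<^sup>2 / (1/6 * (3/2) - (-1/3)\<^sup>2) < (\<alpha> + \<gamma>)\<^sup>2 / (\<alpha> * \<gamma> - \<beta>\<^sup>2))"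
    proof (cases "6 * \<alpha> - 1 = 0")
      case True
      then have "\<alpha> = 1 / 6" by simp
      then show ?thesis using c \<beta> \<gamma> by simp
    next
      case False
      then have "20 * (\<alpha> * \<gamma> - \<beta>\<^sup>2) < (\<alpha> + \<gamma>)\<^sup>2" unfolding sq by simp
      then show ?thesis using c d by (simp add: power2_eq_square less_divide_eq)
    qed
  qed (simp add: circumscribed_def)
  have eq: "eccentricity EO = eccentricity EI"
    using eccentricity_less_conic_iff[OF EI EO] eccentricity_less_conic_iff[OF EO EI]
    by (simp add: power2_eq_square)
  have "eccentricity EI \<noteq> 0"
    using eccentricity_conic(3)[OF EI] by (auto simp: power2_eq_square)
  then have pos: "0 < eccentricity EI" "eccentricity EI < 1"
    using eccentricity_conic(1,2)[OF EI] by simp_all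
  have "convex_quadrilateral ?R"
    using trapezoid_parallelogram by (simp add: trapezoid_def)
  then have "bielliptic ?R"
    unfolding bielliptic_def using min_I min_O eq by metis
  then have "bielliptic_of_class ?R (eccentricity EI)"
    unfolding bielliptic_of_class_def using min_I min_O eq pos less_imp_le by metis
  then show ?thesis
    using pos trapezoid_parallelogram by blast
qed

end
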